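(* Let $D\in\mathbb{C}^{n\times d}$ ($n\le d$) be the overcomplete DFT dictionary, with columns $\phi_1,\dots,\phi_d$. Let $\alpha\in\mathbb{C}^d$ have support $\Omega_{\mathrm{opt}}=\{i:\alpha_i\neq 0\}$ of size $k$ with minimum (cyclic) separation $h_{\min}$, so that $\Omega_{\mathrm{opt}}\in\mathcal{S}_{k,h_{\min}}$. Let $$x=\sum_{i\in\Omega_{\mathrm{opt}}}\alpha_i\phi_i+e,$$ where $e\in\mathbb{C}^n$ satisfies $\|e\|_2<\varepsilon$. Suppose that $\eta_{h_{\min},k}<1$ and $$B(h_{\min}):=\frac{\eta'_{h_{\min},k}}{1-\eta_{h_{\min},k}}<1 .$$ Then Orthogonal Matching Pursuit (OMP), applied to $x$ with dictionary $D$ and with the stopping rule $\|r_i\|_2\le\varepsilon$ (where $r_i$ is the residual after $i$ iterations), exactly recovers $\Omega_{\mathrm{opt}}$ (that is, it terminates and its set of selected indices at termination equals $\Omega_{\mathrm{opt}}$) whenever $$\min_{i\in\Omega_{\mathrm{opt}}}|\alpha_i|\;\ge\;\frac{2\varepsilon}{1-\eta_{h_{\min},k}-\eta'_{h_{\min},k}} .$$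
   Context: DFT dictionary: the $n\times d$ ($n\le d$) overcomplete DFT dictionary $D$ is the matrix with entries $\omega^{jl}/\sqrt{n}$ for $j=0,\dots,n-1$ (rows) and $l=0,\dots,d-1$ (columns), where $\omega=e^{-2\pi \mathrm{i}/d}$. Its columns have unit Euclidean norm. The columns are listed as $\phi_1,\dots,\phi_d$ (relabeling $l\mapsto l+1$). Separation: distance between column indices is measured cyclically modulo $d$: for $p>q$ the distance is $\min(p-q,\,d-p+q)$. For a positive integer $h_{\min}$, let $\mathcal{S}_{k,h_{\min}}$ be the family of index sets $\Omega$ of size $k$ with minimum separation at least $h_{\min}$, i.e. $\min(p-q,\,d-p+q)\ge h_{\min}$ for all $p,q\in\Omega$ with $p>q$. Dominance factors (an empty sum or a maximum over an empty set of indices $p$ is taken as $0$): $$\eta_{h_{\min},k}:=\max_{\Omega\in\mathcal{S}_{k,h_{\min}}}\max_{p\in\Omega}\sum_{q\in\Omega,\,q\ne p}|(D^*D)_{pq}|,\qquad \eta'_{h_{\min},k}:=\max_{\Omega\in\mathcal{S}_{k,h_{\min}}}\max_{p\notin\Omega}\sum_{q\in\Omega}|(D^*D)_{pq}| .$$ OMP: start with $r_0=x$ and $\Omega_0=\varnothing$. At iteration $t=0,1,2,\dots$: if $\|r_t\|_2\le\varepsilon$, stop and output $\Omega_t$. Otherwise choose an index $i_{t+1}\in\arg\max_{i}|\phi_i^*r_t|$ (ties broken arbitrarily), set $\Omega_{t+1}=\Omega_t\cup\{i_{t+1}\}$ and $r_{t+1}=(I-P_{t+1})x$, where $P_{t+1}=D_{\Omega_{t+1}}D_{\Omega_{t+1}}^{\dagger}$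 is the orthogonal projection onto the span of the columns of $D$ indexed by $\Omega_{t+1}$. *)

theory Defs
  imports
    Complex_Main
    "HOL-Analysis.L2_Norm"
    "Jordan_Normal_Form.Matrix"
    "Jordan_Normal_Form.Schur_Decomposition"
    "Jordan_Normal_Form.DL_Submatrix"
begin

text \<open>Dictionary columns are indexed by \<open>0, \<dots>, d - 1\<close>; cyclic distances do not depend on
  whether the indexing starts at 0 or 1.\<close>

definition dft_dictionary :: "nat \<Rightarrow> nat \<Rightarrow> complex mat" where
  "dft_dictionary n d =
     mat n d (\<lambda>(j, l). exp (- 2 * complex_of_real pi * \<i> / of_nat d) ^ (j * l) / complex_of_real (sqrt (real n)))"

definition cvec_norm :: "complex vec \<Rightarrow> real" where
  "cvec_norm v = L2_set (\<lambda>i. cmod (v $ i)) {..<dim_vec v}"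

definition separated_sets :: "nat \<Rightarrow> nat \<Rightarrow> nat \<Rightarrow> nat set set" where
  "separated_sets d k h =
     {\<Omega>. \<Omega> \<subseteq> {..<d} \<and> card \<Omega> = k \<and> (\<forall>p\<in>\<Omega>. \<forall>q\<in>\<Omega>. q < p \<longrightarrow> h \<le> min (p - q) (d - p + q))}"

definition Max0 :: "real set \<Rightarrow> real" where
  "Max0 A = (if A = {} then 0 else Max A)"

definition dominance :: "complex mat \<Rightarrow> nat \<Rightarrow> nat \<Rightarrow> real" where
  "dominance D h k =
     Max ((\<lambda>\<Omega>. Max0 ((\<lambda>p. \<Sum>q\<in>\<Omega> - {p}. cmod ((mat_adjoint D * D) $$ (p, q))) ` \<Omega>))
       ` separated_sets (dim_col D) k h)"

definition dominance' :: "complex mat \<Rightarrow> nat \<Rightarrow> nat \<Rightarrow> real" where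
  "dominance' D h k =
     Max ((\<lambda>\<Omega>. Max0 ((\<lambda>p. \<Sum>q\<in>\<Omega>. cmod ((mat_adjoint D * D) $$ (p, q))) ` ({..<dim_col D} - \<Omega>)))
       ` separated_sets (dim_col D) k h)"

text \<open>The Moore--Penrose inverse is the unique matrix satisfying the four Penrose equations.\<close>

definition is_pseudoinverse :: "complex mat \<Rightarrow> complex mat \<Rightarrow> bool" where
  "is_pseudoinverse A B \<longleftrightarrow>
     B \<in> carrier_mat (dim_col A) (dim_row A) \<and>
     A * B * A = A \<and> B * A * B = B \<and>
     mat_adjoint (A * B) = A * B \<and> mat_adjoint (B * A) = B * A"

definition pseudoinverse :: "complex mat \<Rightarrow> complex mat" where
  "pseudoinverse A = (THE B. is_pseudoinverse A B)"

definition column_projection :: "complex mat \<Rightarrow> nat set \<Rightarrow> complex mat" where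
  "column_projection D \<Omega> = submatrix D UNIV \<Omega> * pseudoinverse (submatrix D UNIV \<Omega>)"

text \<open>A run of orthogonal matching pursuit, given by its selected index sets \<open>\<Omega> t\<close> and residuals
  \<open>r t\<close>, with an arbitrary choice among the maximisers in every iteration. A run that has met the
  stopping rule is continued as a constant sequence.\<close>

definition omp_run ::
  "complex mat \<Rightarrow> complex vec \<Rightarrow> real \<Rightarrow> (nat \<Rightarrow> nat set) \<Rightarrow> (nat \<Rightarrow> complex vec) \<Rightarrow> bool" where
  "omp_run D x \<epsilon> \<Omega> r \<longleftrightarrow>
     \<Omega> 0 = {} \<and> r 0 = x \<and>
     (\<forall>t. if cvec_norm (r t) \<le> \<epsilon>
          then \<Omega> (Suc t) = \<Omega> t \<and> r (Suc t) = r t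
          else (\<exists>i. is_arg_max (\<lambda>i. cmod (r t \<bullet>c col D i)) (\<lambda>i. i < dim_col D) i \<and>
                    \<Omega> (Suc t) = \<Omega> t \<union> {i}) \<and>
               r (Suc t) = (1\<^sub>m (dim_row D) - column_projection D (\<Omega> (Suc t))) *\<^sub>v x)"

definition omp_outputs :: "real \<Rightarrow> (nat \<Rightarrow> nat set) \<Rightarrow> (nat \<Rightarrow> complex vec) \<Rightarrow> nat set \<Rightarrow> bool" where
  "omp_outputs \<epsilon> \<Omega> r S \<longleftrightarrow>
     (\<exists>T. (\<forall>t<T. \<not> cvec_norm (r t) \<le> \<epsilon>) \<and> cvec_norm (r T) \<le> \<epsilon> \<and> \<Omega> T = S)"

lemma omp_run_exists:
  assumes "0 < dim_col D"
  shows "\<exists>\<Omega> r. omp_run D x \<epsilon> \<Omega> r"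
proof -
  define pick_index where "pick_index = (\<lambda>v. SOME i. is_arg_max (\<lambda>i. cmod (v \<bullet>c col D i)) (\<lambda>i. i < dim_col D) i)"
  have pick: "is_arg_max (\<lambda>i. cmod (v \<bullet>c col D i)) (\<lambda>i. i < dim_col D) (pick_index v)" for v
  proof -
    let ?f = "\<lambda>i. cmod (v \<bullet>c col D i)"
    have fin: "finite (?f ` {..<dim_col D})" "?f ` {..<dim_col D} \<noteq> {}"
      using assms by auto
    obtain i where i: "i < dim_col D" "?f i = Max (?f ` {..<dim_col D})"
      using Max_in[OF fin] by auto
    have "is_arg_max ?f (\<lambda>i. i < dim_col D) i"
      unfolding is_arg_max_def using i fin by (auto simp: not_less)
    then show ?thesis
      unfolding pick_index_def by (rule someI)
  qed
  define step where "step = (\<lambda>(S, v).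
    if cvec_norm v \<le> \<epsilon> then (S, v)
    else (S \<union> {pick_index v},
      (1\<^sub>m (dim_row D) - column_projection D (S \<union> {pick_index v})) *\<^sub>v x))"
  define s where "s = (\<lambda>t. (step ^^ t) ({}, x))"
  have s0: "s 0 = ({}, x)" and Suc: "s (Suc t) = step (s t)" for t
    by (simp_all add: s_def)
  have sS: "if cvec_norm (snd (s t)) \<le> \<epsilon>
      then fst (s (Suc t)) = fst (s t) \<and> snd (s (Suc t)) = snd (s t)
      else (\<exists>i. is_arg_max (\<lambda>i. cmod (snd (s t) \<bullet>c col D i)) (\<lambda>i. i < dim_col D) i \<and>
                fst (s (Suc t)) = fst (s t) \<union> {i}) \<and>
           snd (s (Suc t)) = (1\<^sub>m (dim_row D) - column_projection D (fst (s (Suc t)))) *\<^sub>v x" for t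
    unfolding Suc using pick[of "snd (s t)"] by (cases "s t") (auto simp: step_def)
  have "omp_run D x \<epsilon> (\<lambda>t. fst (s t)) (\<lambda>t. snd (s t))"
    unfolding omp_run_def
  proof (intro conjI allI)
    fix t
    show "if cvec_norm (snd (s t)) \<le> \<epsilon>
        then fst (s (Suc t)) = fst (s t) \<and> snd (s (Suc t)) = snd (s t)
        else (\<exists>i. is_arg_max (\<lambda>i. cmod (snd (s t) \<bullet>c col D i)) (\<lambda>i. i < dim_col D) i \<and>
                  fst (s (Suc t)) = fst (s t) \<union> {i}) \<and>
             snd (s (Suc t)) = (1\<^sub>m (dim_row D) - column_projection D (fst (s (Suc t)))) *\<^sub>v x"
      by (rule sS)
  qed (simp_all add: s0)
  then show ?thesis by blast
qed

end

theory Submission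
  imports Defs
begin

text \<open>
  Let \<open>S\<close> be a set of selected indices that is a proper subset of the true support \<open>\<Omega>\<close>. Subtracting from
  the signal its projection onto the columns in \<open>S\<close> changes the coefficients only on \<open>S\<close>. The
  residual is therefore \<open>D \<beta> + f\<close>, where \<open>\<beta>\<close> is supported on \<open>\<Omega>\<close> and agrees with \<open>\<alpha>\<close> off \<open>S\<close>,
  and where \<open>f\<close> is the projected noise, of norm less than \<open>\<epsilon>\<close>. Write \<open>a\<close> and \<open>b\<close> for the two
  dominance factors and \<open>M\<close> for the largest \<open>\<bar>\<beta> p\<bar>\<close>. The columns have unit norm, so the Gram
  matrix has unit diagonal, and its off-diagonal row sums over \<open>\<Omega>\<close> are at most \<open>a\<close> in the rows of
  \<open>\<Omega>\<close> and at most \<open>b\<close> in the other rows. The correlation of the residual with the column at the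
  peak of \<open>\<beta>\<close> exceeds \<open>M (1 - a) - \<epsilon>\<close>, and with a column outside \<open>\<Omega>\<close> it is below \<open>M b + \<epsilon>\<close>.
  Some index of \<open>\<Omega>\<close> is not yet in \<open>S\<close>, and there \<open>\<beta>\<close> has the size of a true coefficient; hence
  \<open>M (1 - a - b) \<ge> 2 \<epsilon>\<close>. This inequality does three things at once.

  \<^item> It makes the first bound at least the second, so no index outside \<open>\<Omega>\<close> is selected.
  \<^item> It makes the peak correlation larger than \<open>\<epsilon> > 0\<close>, whereas the residual is orthogonal to the
    columns in \<open>S\<close>; so no index is selected twice.
  \<^item> It makes the norm of the residual larger than \<open>\<epsilon>\<close>, because correlations with unit vectors
    are at most the norm; so the algorithm does not stop early.

  Every iteration thus adds a new element of \<open>\<Omega>\<close> (lemma \<open>residual_step\<close>). After \<open>card \<Omega>\<close>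
  iterations the signal part is projected away entirely, the residual is the projected noise, and
  the algorithm stops (lemmas \<open>residual_support_le\<close> and \<open>omp_recovers_support\<close>).

  The Moore--Penrose inverse enters the algorithm as a definite description, which says something
  only once existence and uniqueness are known. Uniqueness holds for every matrix. Existence is
  needed for subsets of the support, where \<open>a < 1\<close> makes the selected columns linearly independent,
  so that the explicit formula \<open>(A\<^sup>* A)\<^sup>-\<^sup>1 A\<^sup>*\<close> is available.

  Separation of the support enters through the family of index sets over which the dominance
  factors are maximal, and the DFT structure through the unit norm of the columns. The argument is
  carried out for any dictionary whose Gram matrix has a unit diagonal and such row sums (locale
  \<open>dominant_columns\<close>).
\<close>

section \<open>Adjoints and the Euclidean norm\<close>

lemma index_mat_adjoint:
  fixes A :: "complex mat"
  assumes "i < dim_col A" "j < dim_row A"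
  shows "mat_adjoint A $$ (i, j) = cnj (A $$ (j, i))"
  using assms unfolding mat_adjoint_def by (simp add: mat_of_rows_def)

lemma dim_mat_adjoint [simp]:
  "dim_row (mat_adjoint A) = dim_col A" "dim_col (mat_adjoint A) = dim_row A"
  unfolding mat_adjoint_def by auto

lemma mat_adjoint_carrier [simp]:
  "A \<in> carrier_mat n m \<Longrightarrow> mat_adjoint A \<in> carrier_mat m n"
  by (rule carrier_matI) simp_all

lemma mat_adjoint_adjoint [simp]:
  fixes A :: "complex mat"
  shows "mat_adjoint (mat_adjoint A) = A"
  by (rule eq_matI) (auto simp: index_mat_adjoint)

lemma mat_adjoint_one [simp]: "mat_adjoint (1\<^sub>m n :: complex mat) = 1\<^sub>m n"
  by (rule eq_matI) (auto simp: index_mat_adjoint)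

lemma mat_adjoint_minus:
  fixes A B :: "complex mat"
  assumes "A \<in> carrier_mat n m" "B \<in> carrier_mat n m"
  shows "mat_adjoint (A - B) = mat_adjoint A - mat_adjoint B"
  using assms by (intro eq_matI) (auto simp: index_mat_adjoint)

lemma mat_adjoint_mult:
  fixes A B :: "complex mat"
  assumes "A \<in> carrier_mat n m" "B \<in> carrier_mat m l"
  shows "mat_adjoint (A * B) = mat_adjoint B * mat_adjoint A"
  using assms
  by (intro eq_matI)
    (auto simp: index_mat_adjoint scalar_prod_def mult.commute intro!: sum.cong)

lemma index_mat_adjoint_mult_vec:
  fixes A :: "complex mat"
  assumes "A \<in> carrier_mat n m" "w \<in> carrier_vec n" "p < m"
  shows "(mat_adjoint A *\<^sub>v w) $ p = w \<bullet>c col A p"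
  using assms
  by (auto simp: index_mat_adjoint scalar_prod_def mult.commute intro!: sum.cong)

lemma cscalar_prod_mult_mat_vec:
  fixes A :: "complex mat"
  assumes A: "A \<in> carrier_mat n m" and v: "v \<in> carrier_vec m" and w: "w \<in> carrier_vec n"
  shows "(A *\<^sub>v v) \<bullet>c w = v \<bullet>c (mat_adjoint A *\<^sub>v w)"
proof -
  have "(A *\<^sub>v v) \<bullet>c w = (\<Sum>i = 0..<n. \<Sum>j = 0..<m. A $$ (i, j) * v $ j * cnj (w $ i))"
    using A v w by (auto simp: scalar_prod_def sum_distrib_right intro!: sum.cong)
  also have "\<dots> = (\<Sum>j = 0..<m. \<Sum>i = 0..<n. A $$ (i, j) * v $ j * cnj (w $ i))"
    by (rule sum.swap)
  also have "\<dots> = v \<bullet>c (mat_adjoint A *\<^sub>v w)"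
    using A v w
    by (auto simp: scalar_prod_def index_mat_adjoint sum_distrib_left mult_ac intro!: sum.cong)
  finally show ?thesis .
qed

lemma cvec_norm_nonneg: "0 \<le> cvec_norm v"
  by (simp add: cvec_norm_def L2_set_nonneg)

lemma cscalar_prod_self: "v \<bullet>c v = complex_of_real ((cvec_norm v)\<^sup>2)"
proof -
  have "v \<bullet>c v = (\<Sum>i<dim_vec v. v $ i * cnj (v $ i))"
    unfolding scalar_prod_def by (rule sum.cong) (auto simp: atLeast0LessThan)
  also have "\<dots> = (\<Sum>i<dim_vec v. complex_of_real ((cmod (v $ i))\<^sup>2))"
    by (simp only: complex_norm_square)
  also have "\<dots> = complex_of_real ((cvec_norm v)\<^sup>2)"
    unfolding cvec_norm_def L2_set_def by (subst real_sqrt_pow2) (simp_all add: sum_nonneg)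
  finally show ?thesis .
qed

lemma cvec_norm_Cauchy_Schwarz:
  assumes "dim_vec v = dim_vec w"
  shows "cmod (v \<bullet>c w) \<le> cvec_norm v * cvec_norm w"
proof -
  have "cmod (v \<bullet>c w) \<le> (\<Sum>i<dim_vec w. cmod (v $ i) * cmod (w $ i))"
    unfolding scalar_prod_def
    by (rule order.trans[OF norm_sum]) (simp add: norm_mult atLeast0LessThan)
  also have "\<dots> \<le> cvec_norm v * cvec_norm w"
    unfolding cvec_norm_def using assms L2_set_mult_ineq[of "\<lambda>i. cmod (v $ i)" "\<lambda>i. cmod (w $ i)"]
    by simp
  finally show ?thesis .
qed

text \<open>For a Hermitian idempotent \<open>Q\<close>, moving one factor \<open>Q\<close> across the inner product gives
  \<open>\<parallel>Q v\<parallel>\<^sup>2 = \<langle>v, Q v\<rangle>\<close>; the Cauchy--Schwarz inequality and cancellation of one factor finish.\<close>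

lemma orthogonal_projection_contracts:
  fixes Q :: "complex mat"
  assumes Q: "Q \<in> carrier_mat n n" and idem: "Q * Q = Q" and herm: "mat_adjoint Q = Q"
    and v: "v \<in> carrier_vec n"
  shows "cvec_norm (Q *\<^sub>v v) \<le> cvec_norm v"
proof -
  have "(Q *\<^sub>v v) \<bullet>c (Q *\<^sub>v v) = v \<bullet>c (Q *\<^sub>v (Q *\<^sub>v v))"
    using cscalar_prod_mult_mat_vec[of Q n n v "Q *\<^sub>v v"] Q v herm by simp
  also have "Q *\<^sub>v (Q *\<^sub>v v) = Q *\<^sub>v v"
    using assoc_mult_mat_vec[OF Q Q v] idem by simp
  finally have eq: "(Q *\<^sub>v v) \<bullet>c (Q *\<^sub>v v) = v \<bullet>c (Q *\<^sub>v v)" .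
  have "(cvec_norm (Q *\<^sub>v v))\<^sup>2 = cmod ((Q *\<^sub>v v) \<bullet>c (Q *\<^sub>v v))"
    unfolding cscalar_prod_self by (simp only: norm_of_real) simp
  also have "\<dots> \<le> cvec_norm v * cvec_norm (Q *\<^sub>v v)"
    unfolding eq using Q v by (intro cvec_norm_Cauchy_Schwarz) auto
  finally show ?thesis
    using cvec_norm_nonneg[of v] cvec_norm_nonneg[of "Q *\<^sub>v v"]
    by (cases "cvec_norm (Q *\<^sub>v v) = 0") (auto simp: power2_eq_square)
qed

section \<open>The Moore--Penrose inverse of an injective matrix\<close>

text \<open>Two generalised inverses give the same projections, \<open>A B = A C\<close> and \<open>B A = C A\<close>: each product
  absorbs the other on one side, and taking adjoints turns this into absorption on the other side.
  Then \<open>B = B A B = C A B = C A C = C\<close>.\<close>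

lemma is_pseudoinverse_unique:
  assumes B: "is_pseudoinverse A B" and C: "is_pseudoinverse A C"
  shows "B = C"
proof -
  define n m where "n = dim_row A" and "m = dim_col A"
  have cA: "A \<in> carrier_mat n m" by (simp add: n_def m_def)
  have cB: "B \<in> carrier_mat m n" and cC: "C \<in> carrier_mat m n"
    and B1: "A * B * A = A" and B2: "B * A * B = B" and B3: "mat_adjoint (A * B) = A * B"
    and B4: "mat_adjoint (B * A) = B * A"
    and C1: "A * C * A = A" and C2: "C * A * C = C" and C3: "mat_adjoint (A * C) = A * C"
    and C4: "mat_adjoint (C * A) = C * A"
    using B C unfolding is_pseudoinverse_def n_def m_def by auto
  have cAB: "A * B \<in> carrier_mat n n" and cAC: "A * C \<in> carrier_mat n n"
    and cBA: "B * A \<in> carrier_mat m m" and cCA: "C * A \<in> carrier_mat m m"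
    by (rule mult_carrier_mat[OF cA cB] mult_carrier_mat[OF cA cC]
        mult_carrier_mat[OF cB cA] mult_carrier_mat[OF cC cA])+
  have "A * B = A * C * A * B" by (simp only: C1)
  also have "\<dots> = (A * C) * (A * B)" by (rule assoc_mult_mat[OF cAC cA cB])
  also have "\<dots> = mat_adjoint ((A * B) * (A * C))"
    by (simp only: mat_adjoint_mult[OF cAB cAC] B3 C3)
  also have "(A * B) * (A * C) = A * B * A * C" by (rule assoc_mult_mat[OF cAB cA cC, symmetric])
  also have "mat_adjoint \<dots> = A * C" by (simp only: B1 C3)
  finally have AB: "A * B = A * C" .
  have "B * A = B * (A * C * A)" by (simp only: C1)
  also have "\<dots> = (B * A) * (C * A)"
    by (simp only: assoc_mult_mat[OF cA cC cA] assoc_mult_mat[OF cB cA cCA])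
  also have "\<dots> = mat_adjoint ((C * A) * (B * A))"
    by (simp only: mat_adjoint_mult[OF cCA cBA] B4 C4)
  also have "(C * A) * (B * A) = C * (A * B * A)"
    by (simp only: assoc_mult_mat[OF cC cA cBA] assoc_mult_mat[OF cA cB cA])
  also have "mat_adjoint \<dots> = C * A" by (simp only: B1 C4)
  finally have BA: "B * A = C * A" .
  have "B = (B * A) * B" by (simp only: B2)
  also have "\<dots> = C * (A * B)" unfolding BA by (rule assoc_mult_mat[OF cC cA cB])
  also have "\<dots> = (C * A) * C" unfolding AB by (rule assoc_mult_mat[OF cC cA cC, symmetric])
  finally show ?thesis by (simp only: C2)
qed

text \<open>If \<open>A\<^sup>* A y = 0\<close>, then \<open>\<parallel>A y\<parallel>\<^sup>2 = \<langle>y, A\<^sup>* A y\<rangle> = 0\<close>. So injectivity of \<open>A\<close> makes the square matrix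
  \<open>A\<^sup>* A\<close> invertible, and \<open>(A\<^sup>* A)\<^sup>-\<^sup>1 A\<^sup>*\<close> is a left inverse of \<open>A\<close>, from which the Penrose
  equations follow.\<close>

lemma is_pseudoinverse_exists:
  fixes A :: "complex mat"
  assumes A: "A \<in> carrier_mat n m"
    and inj: "\<And>y. y \<in> carrier_vec m \<Longrightarrow> A *\<^sub>v y = 0\<^sub>v n \<Longrightarrow> y = 0\<^sub>v m"
  shows "\<exists>B. is_pseudoinverse A B"
proof -
  define H where "H = mat_adjoint A * A"
  have As: "mat_adjoint A \<in> carrier_mat m n" using A by simp
  have H: "H \<in> carrier_mat m m" unfolding H_def by (rule mult_carrier_mat[OF As A])
  have "y = 0\<^sub>v m" if y: "y \<in> carrier_vec m" and 0: "H *\<^sub>v y = 0\<^sub>v m" for y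
  proof -
    have Ay: "A *\<^sub>v y \<in> carrier_vec n" using A y by simp
    have "(A *\<^sub>v y) \<bullet>c (A *\<^sub>v y) = y \<bullet>c (mat_adjoint A *\<^sub>v (A *\<^sub>v y))"
      by (rule cscalar_prod_mult_mat_vec[OF A y Ay])
    also have "mat_adjoint A *\<^sub>v (A *\<^sub>v y) = 0\<^sub>v m"
      using assoc_mult_mat_vec[OF As A y] 0 by (simp add: H_def)
    also have "y \<bullet>c 0\<^sub>v m = 0" using y by simp
    finally show ?thesis using conjugate_square_eq_0_vec[OF Ay] inj[OF y] by simp
  qed
  then have "det H \<noteq> 0" using det_0_iff_vec_prod_zero_field[OF H] by blast
  then obtain K where K: "K \<in> carrier_mat m m" and KH: "K * H = 1\<^sub>m m"
    using det_non_zero_imp_unit[OF H] unfolding Units_def by (auto simp: ring_mat_def)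
  have HK: "H * K = 1\<^sub>m m" using mat_mult_left_right_inverse[OF K H KH] .
  have Hs: "mat_adjoint H = H" unfolding H_def using A by (simp add: mat_adjoint_mult[OF As A])
  \<comment> \<open>The inverse of a Hermitian matrix is Hermitian.\<close>
  have Ks: "mat_adjoint K = K"
  proof -
    have cKs: "mat_adjoint K \<in> carrier_mat m m" using K by simp
    have 1: "mat_adjoint K * H = 1\<^sub>m m"
      using mat_adjoint_mult[OF H K] HK Hs by simp
    have "mat_adjoint K = mat_adjoint K * (H * K)" unfolding HK by (rule right_mult_one_mat[OF cKs, symmetric])
    also have "\<dots> = mat_adjoint K * H * K" by (rule assoc_mult_mat[OF cKs H K, symmetric])
    also have "\<dots> = K" using K by (simp add: 1)
    finally show ?thesis .
  qed
  define B where "B = K * mat_adjoint A"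
  have B: "B \<in> carrier_mat m n" unfolding B_def by (rule mult_carrier_mat[OF K As])
  have BA: "B * A = 1\<^sub>m m" unfolding B_def assoc_mult_mat[OF K As A] using KH by (simp add: H_def)
  have ABs: "mat_adjoint (A * B) = A * B"
  proof -
    have "mat_adjoint (A * B) = (A * mat_adjoint K) * mat_adjoint A"
      unfolding mat_adjoint_mult[OF A B] unfolding B_def mat_adjoint_mult[OF K As] by simp
    also have "\<dots> = A * B" unfolding Ks B_def by (rule assoc_mult_mat[OF A K As])
    finally show ?thesis .
  qed
  have "is_pseudoinverse A B"
    unfolding is_pseudoinverse_def
    using A B ABs BA assoc_mult_mat[OF A B A] by auto
  then show ?thesis by blast
qed

lemma is_pseudoinverse_pseudoinverse:
  fixes A :: "complex mat"
  assumes "A \<in> carrier_mat n m"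
    and "\<And>y. y \<in> carrier_vec m \<Longrightarrow> A *\<^sub>v y = 0\<^sub>v n \<Longrightarrow> y = 0\<^sub>v m"
  shows "is_pseudoinverse A (pseudoinverse A)"
proof -
  have "\<exists>B. is_pseudoinverse A B"
    by (rule is_pseudoinverse_exists[OF assms(1)]) (rule assms(2))
  then obtain B where B: "is_pseudoinverse A B" ..
  show ?thesis unfolding pseudoinverse_def
  proof (rule theI)
    show "is_pseudoinverse A B" by (rule B)
    show "C = B" if "is_pseudoinverse A C" for C by (rule is_pseudoinverse_unique[OF that B])
  qed
qed

section \<open>Projection onto the span of selected columns\<close>

text \<open>Coefficient vectors keep the full length \<open>d\<close> of the dictionary, with zeros off the index set.
  In this way combinations of different selections of columns can be added and subtracted without
  renumbering.\<close>

definition supported_vec :: "nat \<Rightarrow> nat set \<Rightarrow> complex vec set" where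
  "supported_vec d S = {\<beta> \<in> carrier_vec d. \<forall>i<d. i \<notin> S \<longrightarrow> \<beta> $ i = 0}"

definition columns_independent :: "complex mat \<Rightarrow> nat set \<Rightarrow> bool" where
  "columns_independent D S \<longleftrightarrow>
     (\<forall>\<beta>\<in>supported_vec (dim_col D) S. D *\<^sub>v \<beta> = 0\<^sub>v (dim_row D) \<longrightarrow> \<beta> = 0\<^sub>v (dim_col D))"

lemma bij_betw_pick:
  assumes "finite S"
  shows "bij_betw (pick S) {..<card S} S"
proof (rule bij_betw_byWitness[where f' = "\<lambda>i. card {a \<in> S. a < i}"])
  show "\<forall>j\<in>{..<card S}. card {a \<in> S. a < pick S j} = j"
    using card_pick_le by auto
  show "\<forall>i\<in>S. pick S (card {a \<in> S. a < i}) = i" by (simp add: pick_card_in_set)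
  show "pick S ` {..<card S} \<subseteq> S" using pick_in_set_le by auto
  show "(\<lambda>i. card {a \<in> S. a < i}) ` S \<subseteq> {..<card S}"
    using assms by (auto intro!: psubset_card_mono)
qed

lemma submatrix_columns_carrier:
  assumes "D \<in> carrier_mat n d" "S \<subseteq> {..<d}"
  shows "submatrix D UNIV S \<in> carrier_mat n (card S)"
proof -
  have *: "{j. j < d \<and> j \<in> S} = S" using assms(2) by auto
  show ?thesis using assms(1) by (intro carrier_matI) (simp_all add: dim_submatrix *)
qed

lemma submatrix_columns_index:
  assumes "D \<in> carrier_mat n d" "S \<subseteq> {..<d}" "i < n" "j < card S"
  shows "submatrix D UNIV S $$ (i, j) = D $$ (i, pick S j)"
proof -
  have *: "{j. j < d \<and> j \<in> S} = S" using assms(2) by auto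
  show ?thesis using assms by (simp add: submatrix_index pick_UNIV *)
qed

text \<open>Translates coefficients numbered by position within the submatrix into coefficients numbered by
  dictionary index. The last conclusion keeps the translation injective, which is needed to pass from
  independence of the dictionary columns to injectivity of the submatrix.\<close>

lemma submatrix_columns_mult_vec:
  fixes D :: "complex mat"
  assumes D: "D \<in> carrier_mat n d" and S: "S \<subseteq> {..<d}" and y: "y \<in> carrier_vec (card S)"
  obtains \<beta> where "\<beta> \<in> supported_vec d S" "submatrix D UNIV S *\<^sub>v y = D *\<^sub>v \<beta>"
    "\<And>j. j < card S \<Longrightarrow> \<beta> $ pick S j = y $ j"
proof -
  have fin: "finite S" using S finite_subset by blast
  define \<beta> where "\<beta> = vec d (\<lambda>i. if i \<in> S then y $ card {a \<in> S. a < i} else 0)"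
  have pS: "pick S j \<in> S" "pick S j < d" if "j < card S" for j
    using that pick_in_set_le[of j S] S by auto
  have \<beta>p: "\<beta> $ pick S j = y $ j" if "j < card S" for j
    using pS[OF that] card_pick_le[of j S] that by (auto simp: \<beta>_def)
  have A: "submatrix D UNIV S \<in> carrier_mat n (card S)"
    by (rule submatrix_columns_carrier[OF D S])
  have "submatrix D UNIV S *\<^sub>v y = D *\<^sub>v \<beta>"
  proof (rule eq_vecI)
    fix i assume "i < dim_vec (D *\<^sub>v \<beta>)"
    then have i: "i < n" using D by simp
    have "(submatrix D UNIV S *\<^sub>v y) $ i = (\<Sum>j<card S. submatrix D UNIV S $$ (i, j) * y $ j)"
      using A y i by (simp add: scalar_prod_def atLeast0LessThan)
    also have "\<dots> = (\<Sum>j<card S. D $$ (i, pick S j) * \<beta> $ pick S j)"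
      by (rule sum.cong) (auto simp: submatrix_columns_index[OF D S i] \<beta>p)
    also have "\<dots> = (\<Sum>l\<in>S. D $$ (i, l) * \<beta> $ l)"
      by (rule sum.reindex_bij_betw[OF bij_betw_pick[OF fin]])
    also have "\<dots> = (\<Sum>l<d. D $$ (i, l) * \<beta> $ l)"
      by (rule sum.mono_neutral_left) (use S in \<open>auto simp: \<beta>_def\<close>)
    also have "\<dots> = (D *\<^sub>v \<beta>) $ i"
      using D i by (simp add: scalar_prod_def atLeast0LessThan \<beta>_def)
    finally show "(submatrix D UNIV S *\<^sub>v y) $ i = (D *\<^sub>v \<beta>) $ i" .
  qed (use A D in auto)
  moreover have "\<beta> \<in> supported_vec d S" by (auto simp: supported_vec_def \<beta>_def)
  ultimately show ?thesis using \<beta>p that by blast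
qed

lemma is_pseudoinverse_columns:
  assumes D: "D \<in> carrier_mat n d" and S: "S \<subseteq> {..<d}" and ind: "columns_independent D S"
  shows "is_pseudoinverse (submatrix D UNIV S) (pseudoinverse (submatrix D UNIV S))"
proof (rule is_pseudoinverse_pseudoinverse[OF submatrix_columns_carrier[OF D S]])
  fix y :: "complex vec"
  assume y: "y \<in> carrier_vec (card S)" and 0: "submatrix D UNIV S *\<^sub>v y = 0\<^sub>v n"
  obtain \<beta> where \<beta>: "\<beta> \<in> supported_vec d S" "submatrix D UNIV S *\<^sub>v y = D *\<^sub>v \<beta>"
    "\<And>j. j < card S \<Longrightarrow> \<beta> $ pick S j = y $ j"
    using submatrix_columns_mult_vec[OF D S y] by blast
  have \<beta>0: "\<beta> = 0\<^sub>v d" using ind \<beta>(1,2) 0 D by (auto simp: columns_independent_def)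
  have "y $ j = 0" if j: "j < card S" for j
  proof -
    have "pick S j < d" using pick_in_set_le[OF j] S by auto
    then show ?thesis using \<beta>(3)[OF j] by (simp add: \<beta>0)
  qed
  then show "y = 0\<^sub>v (card S)" using y by (intro eq_vecI) auto
qed

text \<open>What the algorithm needs to know about its projection. All of it follows from the Penrose
  equations: \<open>A B\<close> is Hermitian, and \<open>A B A = A\<close> says both that \<open>A B\<close> is idempotent and that it
  fixes every column of \<open>A\<close>.\<close>

lemma column_projection_properties:
  assumes D: "D \<in> carrier_mat n d" and S: "S \<subseteq> {..<d}" and ind: "columns_independent D S"
  shows column_projection_carrier: "column_projection D S \<in> carrier_mat n n"
    and column_projection_idem: "column_projection D S * column_projection D S = column_projection D S"
    and column_projection_adjoint: "mat_adjoint (column_projection D S) = column_projection D S"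
    and column_projection_col: "i \<in> S \<Longrightarrow> column_projection D S *\<^sub>v col D i = col D i"
    and column_projection_range:
      "v \<in> carrier_vec n \<Longrightarrow> \<exists>\<beta>\<in>supported_vec d S. column_projection D S *\<^sub>v v = D *\<^sub>v \<beta>"
proof -
  define A B where "A = submatrix D UNIV S" and "B = pseudoinverse A"
  have A: "A \<in> carrier_mat n (card S)" unfolding A_def by (rule submatrix_columns_carrier[OF D S])
  have "is_pseudoinverse A B"
    unfolding A_def B_def by (rule is_pseudoinverse_columns[OF D S ind])
  then have B: "B \<in> carrier_mat (card S) n" and ABA: "A * B * A = A"
    and herm: "mat_adjoint (A * B) = A * B"
    using A unfolding is_pseudoinverse_def by auto
  have P: "column_projection D S = A * B" by (simp add: column_projection_def A_def B_def)
  have AB: "A * B \<in> carrier_mat n n" by (rule mult_carrier_mat[OF A B])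
  show "column_projection D S \<in> carrier_mat n n" unfolding P by (rule AB)
  show "column_projection D S * column_projection D S = column_projection D S"
    unfolding P using assoc_mult_mat[OF AB A B] ABA by simp
  show "mat_adjoint (column_projection D S) = column_projection D S" unfolding P by (rule herm)
  show "column_projection D S *\<^sub>v col D i = col D i" if "i \<in> S"
  proof -
    have fin: "finite S" using S finite_subset by blast
    obtain j where j: "j < card S" "pick S j = i"
      using bij_betw_imp_surj_on[OF bij_betw_pick[OF fin]] \<open>i \<in> S\<close> by (metis imageE lessThan_iff)
    have i: "i < d" using S \<open>i \<in> S\<close> by auto
    have c: "col A j = col D i"
      by (rule eq_vecI)
        (use D A i j submatrix_columns_index[OF D S _ j(1)] in \<open>auto simp: A_def\<close>)
    have "A * B *\<^sub>v col A j = col (A * B * A) j" using col_mult2[OF AB A j(1)] by simp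
    then show ?thesis unfolding P ABA c .
  qed
  show "\<exists>\<beta>\<in>supported_vec d S. column_projection D S *\<^sub>v v = D *\<^sub>v \<beta>" if v: "v \<in> carrier_vec n"
  proof -
    have "B *\<^sub>v v \<in> carrier_vec (card S)" using B v by simp
    then obtain \<beta> where "\<beta> \<in> supported_vec d S" "A *\<^sub>v (B *\<^sub>v v) = D *\<^sub>v \<beta>"
      unfolding A_def by (rule submatrix_columns_mult_vec[OF D S])
    then show ?thesis unfolding P assoc_mult_mat_vec[OF A B v] by blast
  qed
qed


section \<open>Residuals of orthogonal matching pursuit\<close>

definition residual :: "complex mat \<Rightarrow> complex vec \<Rightarrow> nat set \<Rightarrow> complex vec" where
  "residual D x S = (1\<^sub>m (dim_row D) - column_projection D S) *\<^sub>v x"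

lemma residual_properties:
  assumes D: "D \<in> carrier_mat n d" and S: "S \<subseteq> {..<d}" and ind: "columns_independent D S"
    and x: "x \<in> carrier_vec n"
  shows residual_carrier: "residual D x S \<in> carrier_vec n"
    and cvec_norm_residual_le: "cvec_norm (residual D x S) \<le> cvec_norm x"
    and residual_orthogonal: "i \<in> S \<Longrightarrow> residual D x S \<bullet>c col D i = 0"
    and residual_add: "y \<in> carrier_vec n \<Longrightarrow> residual D (x + y) S = residual D x S + residual D y S"
    and residual_eq_minus: "residual D x S = x - column_projection D S *\<^sub>v x"
proof -
  define P where "P = column_projection D S"
  define Q where "Q = 1\<^sub>m n - P"
  note P_facts = column_projection_carrier[OF D S ind] column_projection_idem[OF D S ind]
    column_projection_adjoint[OF D S ind]
  have P: "P \<in> carrier_mat n n" and PP: "P * P = P" and Ps: "mat_adjoint P = P"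
    using P_facts by (simp_all add: P_def)
  have 1: "1\<^sub>m n \<in> carrier_mat n n" by simp
  have Q: "Q \<in> carrier_mat n n" unfolding Q_def by (rule minus_carrier_mat[OF P])
  have r: "residual D v S = Q *\<^sub>v v" for v using D by (simp add: residual_def Q_def P_def)
  have Qv: "Q *\<^sub>v v = v - P *\<^sub>v v" if "v \<in> carrier_vec n" for v
    unfolding Q_def using minus_mult_distrib_mat_vec[OF 1 P that] that by simp
  have Qs: "mat_adjoint Q = Q"
    unfolding Q_def by (simp add: mat_adjoint_minus[OF 1 P] Ps)
  have "P * Q = 0\<^sub>m n n"
    unfolding Q_def using mult_minus_distrib_mat[OF P 1 P] P PP by simp
  then have "Q * Q = Q - 0\<^sub>m n n"
    using minus_mult_distrib_mat[OF 1 P Q] Q by (simp add: Q_def[symmetric])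
  also have "\<dots> = Q" using Q by (intro eq_matI) auto
  finally have QQ: "Q * Q = Q" .
  show "residual D x S \<in> carrier_vec n" unfolding r using Q x by simp
  show "cvec_norm (residual D x S) \<le> cvec_norm x"
    unfolding r by (rule orthogonal_projection_contracts[OF Q QQ Qs x])
  show "residual D x S \<bullet>c col D i = 0" if "i \<in> S"
  proof -
    have c: "col D i \<in> carrier_vec n" using D by (metis carrier_matD(1) col_dim)
    have "Q *\<^sub>v col D i = 0\<^sub>v n"
      unfolding Qv[OF c] P_def column_projection_col[OF D S ind that] using c by simp
    then have "(Q *\<^sub>v x) \<bullet>c col D i = x \<bullet>c 0\<^sub>v n"
      using cscalar_prod_mult_mat_vec[OF Q x c] Qs by simp
    then show ?thesis unfolding r using x by simp
  qed
  show "residual D (x + y) S = residual D x S + residual D y S" if "y \<in> carrier_vec n"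
    unfolding r by (rule mult_add_distrib_mat_vec[OF Q x that])
  show "residual D x S = x - column_projection D S *\<^sub>v x"
    unfolding r Qv[OF x] P_def ..
qed

text \<open>The part removed from a signal is a combination of the columns in \<open>S\<close>. Hence taking the residual
  alters coefficients on \<open>S\<close> only, and a signal supported on \<open>\<Omega>\<close> remains so.\<close>

lemma residual_mult_mat_vec:
  assumes D: "D \<in> carrier_mat n d" and S: "S \<subseteq> {..<d}" and ind: "columns_independent D S"
    and \<alpha>: "\<alpha> \<in> supported_vec d \<Omega>" and sub: "S \<subseteq> \<Omega>"
  obtains \<beta> where "\<beta> \<in> supported_vec d \<Omega>" "\<And>i. i < d \<Longrightarrow> i \<notin> S \<Longrightarrow> \<beta> $ i = \<alpha> $ i"
    "residual D (D *\<^sub>v \<alpha>) S = D *\<^sub>v \<beta>"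
proof -
  have \<alpha>c: "\<alpha> \<in> carrier_vec d" using \<alpha> by (simp add: supported_vec_def)
  have x: "D *\<^sub>v \<alpha> \<in> carrier_vec n" using D \<alpha>c by simp
  obtain \<gamma> where \<gamma>: "\<gamma> \<in> supported_vec d S" "column_projection D S *\<^sub>v (D *\<^sub>v \<alpha>) = D *\<^sub>v \<gamma>"
    using column_projection_range[OF D S ind x] by blast
  have \<gamma>c: "\<gamma> \<in> carrier_vec d" using \<gamma> by (simp add: supported_vec_def)
  have "residual D (D *\<^sub>v \<alpha>) S = D *\<^sub>v (\<alpha> - \<gamma>)"
    using residual_eq_minus[OF D S ind x] \<gamma>(2) mult_minus_distrib_mat_vec[OF D \<alpha>c \<gamma>c] by simp
  moreover have off_S: "(\<alpha> - \<gamma>) $ i = \<alpha> $ i" if "i < d" "i \<notin> S" for i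
    using \<gamma> \<gamma>c \<alpha>c that by (auto simp: supported_vec_def)
  moreover have "(\<alpha> - \<gamma>) $ i = 0" if "i < d" "i \<notin> \<Omega>" for i
    using off_S[of i] \<alpha> sub that by (auto simp: supported_vec_def)
  then have "\<alpha> - \<gamma> \<in> supported_vec d \<Omega>"
    using \<alpha>c \<gamma>c by (simp add: supported_vec_def)
  ultimately show ?thesis using that[of "\<alpha> - \<gamma>"] by simp
qed

section \<open>Columns with a diagonally dominant Gram matrix\<close>

lemma cscalar_prod_mult_supported:
  assumes D: "D \<in> carrier_mat n d" and \<Omega>: "\<Omega> \<subseteq> {..<d}" and \<beta>: "\<beta> \<in> supported_vec d \<Omega>" and p: "p < d"
  shows "(D *\<^sub>v \<beta>) \<bullet>c col D p = (\<Sum>q\<in>\<Omega>. (mat_adjoint D * D) $$ (p, q) * \<beta> $ q)"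
proof -
  have Ds: "mat_adjoint D \<in> carrier_mat d n" using D by simp
  have \<beta>c: "\<beta> \<in> carrier_vec d" using \<beta> by (simp add: supported_vec_def)
  have G: "mat_adjoint D * D \<in> carrier_mat d d" by (rule mult_carrier_mat[OF Ds D])
  have "(D *\<^sub>v \<beta>) \<bullet>c col D p = (mat_adjoint D *\<^sub>v (D *\<^sub>v \<beta>)) $ p"
    using D \<beta>c p by (intro index_mat_adjoint_mult_vec[symmetric]) auto
  also have "\<dots> = ((mat_adjoint D * D) *\<^sub>v \<beta>) $ p"
    by (simp only: assoc_mult_mat_vec[OF Ds D \<beta>c])
  also have "\<dots> = (\<Sum>q<d. (mat_adjoint D * D) $$ (p, q) * \<beta> $ q)"
  proof -
    have "((mat_adjoint D * D) *\<^sub>v \<beta>) $ p = row (mat_adjoint D * D) p \<bullet> \<beta>"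
      using G p by (simp del: index_mult_mat)
    also have "\<dots> = (\<Sum>q<d. (mat_adjoint D * D) $$ (p, q) * \<beta> $ q)"
      unfolding scalar_prod_def using G \<beta>c p D
      by (intro sum.cong) (auto simp del: index_mult_mat(1))
    finally show ?thesis .
  qed
  also have "\<dots> = (\<Sum>q\<in>\<Omega>. (mat_adjoint D * D) $$ (p, q) * \<beta> $ q)"
    using \<Omega> \<beta> by (intro sum.mono_neutral_right) (auto simp: supported_vec_def)
  finally show ?thesis .
qed

text \<open>The hypotheses on the dictionary under which recovery is proved: \<open>a\<close> bounds the total
  correlation of a column of \<open>\<Omega>\<close> with the other columns of \<open>\<Omega>\<close>, and \<open>b\<close> that of a column outside
  \<open>\<Omega>\<close> with all columns of \<open>\<Omega>\<close>. If \<open>\<Omega>\<close> is the whole index range, the bound on \<open>b\<close> from row sums is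
  vacuous, so its nonnegativity is a separate assumption.\<close>

locale dominant_columns =
  fixes D :: "complex mat" and n d :: nat and \<Omega> :: "nat set" and a b :: real
  assumes D: "D \<in> carrier_mat n d" and \<Omega>: "\<Omega> \<subseteq> {..<d}"
    and gram_diag: "\<And>p. p < d \<Longrightarrow> (mat_adjoint D * D) $$ (p, p) = 1"
    and row_sum_in: "\<And>p. p \<in> \<Omega> \<Longrightarrow> (\<Sum>q\<in>\<Omega> - {p}. cmod ((mat_adjoint D * D) $$ (p, q))) \<le> a"
    and row_sum_out: "\<And>p. p < d \<Longrightarrow> p \<notin> \<Omega> \<Longrightarrow> (\<Sum>q\<in>\<Omega>. cmod ((mat_adjoint D * D) $$ (p, q))) \<le> b"
    and b_nonneg: "0 \<le> b" and ab: "a + b < 1"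
begin

lemma finite_\<Omega>: "finite \<Omega>"
  using \<Omega> finite_subset by blast

lemma correlation_sum_le:
  assumes J: "J \<subseteq> \<Omega>" and M: "\<And>q. q \<in> \<Omega> \<Longrightarrow> cmod (\<beta> $ q) \<le> M"
  shows "cmod (\<Sum>q\<in>J. (mat_adjoint D * D) $$ (p, q) * \<beta> $ q)
    \<le> M * (\<Sum>q\<in>J. cmod ((mat_adjoint D * D) $$ (p, q)))"
  unfolding sum_distrib_left
proof (rule order.trans[OF norm_sum], rule sum_mono)
  fix q assume "q \<in> J"
  then have "cmod (\<beta> $ q) \<le> M" using J M by auto
  then show "cmod ((mat_adjoint D * D) $$ (p, q) * \<beta> $ q)
      \<le> M * cmod ((mat_adjoint D * D) $$ (p, q))"
    unfolding norm_mult by (subst mult.commute) (rule mult_right_mono, simp_all)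
qed

lemma correlation_outside_le:
  assumes \<beta>: "\<beta> \<in> supported_vec d \<Omega>" and M: "\<And>q. q \<in> \<Omega> \<Longrightarrow> cmod (\<beta> $ q) \<le> M"
    and M0: "0 \<le> M" and p: "p < d" "p \<notin> \<Omega>"
  shows "cmod ((D *\<^sub>v \<beta>) \<bullet>c col D p) \<le> M * b"
proof -
  have "cmod ((D *\<^sub>v \<beta>) \<bullet>c col D p) \<le> M * (\<Sum>q\<in>\<Omega>. cmod ((mat_adjoint D * D) $$ (p, q)))"
    unfolding cscalar_prod_mult_supported[OF D \<Omega> \<beta> p(1)]
    by (rule correlation_sum_le) (use M in auto)
  also have "\<dots> \<le> M * b" by (rule mult_left_mono[OF row_sum_out[OF p] M0])
  finally show ?thesis .
qed

text \<open>At an index where \<open>\<bar>\<beta>\<bar>\<close> is largest, the unit diagonal contributes \<open>\<beta> p\<close> itself, while the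
  other columns together contribute at most \<open>\<bar>\<beta> p\<bar> a\<close>.\<close>

lemma correlation_at_peak_ge:
  assumes \<beta>: "\<beta> \<in> supported_vec d \<Omega>" and p: "p \<in> \<Omega>"
    and M: "\<And>q. q \<in> \<Omega> \<Longrightarrow> cmod (\<beta> $ q) \<le> cmod (\<beta> $ p)"
  shows "cmod (\<beta> $ p) * (1 - a) \<le> cmod ((D *\<^sub>v \<beta>) \<bullet>c col D p)"
proof -
  let ?G = "mat_adjoint D * D"
  have pd: "p < d" using p \<Omega> by auto
  have "(D *\<^sub>v \<beta>) \<bullet>c col D p = \<beta> $ p + (\<Sum>q\<in>\<Omega> - {p}. ?G $$ (p, q) * \<beta> $ q)"
    unfolding cscalar_prod_mult_supported[OF D \<Omega> \<beta> pd] sum.remove[OF finite_\<Omega> p]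
      gram_diag[OF pd] by simp
  moreover have "cmod (\<Sum>q\<in>\<Omega> - {p}. ?G $$ (p, q) * \<beta> $ q)
      \<le> cmod (\<beta> $ p) * (\<Sum>q\<in>\<Omega> - {p}. cmod (?G $$ (p, q)))"
    by (rule correlation_sum_le) (use M in auto)
  moreover have "\<dots> \<le> cmod (\<beta> $ p) * a" by (rule mult_left_mono[OF row_sum_in[OF p]]) simp
  ultimately show ?thesis
    using norm_diff_ineq[of "\<beta> $ p" "\<Sum>q\<in>\<Omega> - {p}. ?G $$ (p, q) * \<beta> $ q"]
    by (simp add: algebra_simps)
qed

lemma exists_peak:
  assumes "\<Omega> \<noteq> {}"
  obtains p where "p \<in> \<Omega>" "\<And>q. q \<in> \<Omega> \<Longrightarrow> cmod (\<beta> $ q) \<le> cmod (\<beta> $ p)"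
proof -
  let ?V = "(\<lambda>q. cmod (\<beta> $ q)) ` \<Omega>"
  have fin: "finite ?V" "?V \<noteq> {}" using finite_\<Omega> assms by auto
  obtain p where "p \<in> \<Omega>" "cmod (\<beta> $ p) = Max ?V" using Max_in[OF fin] by auto
  then show ?thesis using that[of p] Max_ge[OF fin(1)] by auto
qed

text \<open>Nonsingularity of a diagonally dominant Gram matrix: the bound at the peak of \<open>\<beta>\<close> forces the
  peak to vanish.\<close>

lemma uncorrelated_imp_zero:
  assumes \<beta>: "\<beta> \<in> supported_vec d \<Omega>" and 0: "\<And>p. p \<in> \<Omega> \<Longrightarrow> (D *\<^sub>v \<beta>) \<bullet>c col D p = 0"
  shows "\<beta> = 0\<^sub>v d"
proof (rule eq_vecI)
  fix q assume "q < dim_vec (0\<^sub>v d :: complex vec)"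
  then have q: "q < d" by simp
  have "\<beta> $ q = 0"
  proof (cases "q \<in> \<Omega>")
    case True
    then obtain p where p: "p \<in> \<Omega>" "\<And>q. q \<in> \<Omega> \<Longrightarrow> cmod (\<beta> $ q) \<le> cmod (\<beta> $ p)"
      using exists_peak[of \<beta>] by blast
    have "cmod (\<beta> $ p) * (1 - a) \<le> 0" using correlation_at_peak_ge[OF \<beta> p] 0[OF p(1)] by simp
    then have "cmod (\<beta> $ p) \<le> 0" using ab b_nonneg by (simp add: mult_le_0_iff)
    then show ?thesis using p(2)[OF True] by simp
  next
    case False
    then show ?thesis using \<beta> q by (auto simp: supported_vec_def)
  qed
  then show "\<beta> $ q = 0\<^sub>v d $ q" using q by simp
qed (use \<beta> in \<open>auto simp: supported_vec_def\<close>)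

lemma columns_independent_subset:
  assumes "S \<subseteq> \<Omega>"
  shows "columns_independent D S"
  unfolding columns_independent_def
proof (intro ballI impI)
  fix \<beta> assume \<beta>S: "\<beta> \<in> supported_vec (dim_col D) S" and 0: "D *\<^sub>v \<beta> = 0\<^sub>v (dim_row D)"
  have "\<beta> \<in> supported_vec d \<Omega>" using \<beta>S assms D by (auto simp: supported_vec_def)
  then have "\<beta> = 0\<^sub>v d" by (rule uncorrelated_imp_zero) (simp add: 0)
  then show "\<beta> = 0\<^sub>v (dim_col D)" using D by simp
qed

lemma cmod_cscalar_col_le:
  assumes v: "v \<in> carrier_vec n" and p: "p < d"
  shows "cmod (v \<bullet>c col D p) \<le> cvec_norm v"
proof -
  have c: "col D p \<in> carrier_vec n" using D by (metis carrier_matD(1) col_dim)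
  have "complex_of_real ((cvec_norm (col D p))\<^sup>2) = col D p \<bullet>c col D p"
    by (simp only: cscalar_prod_self)
  also have "\<dots> = (mat_adjoint D *\<^sub>v col D p) $ p"
    by (rule index_mat_adjoint_mult_vec[OF D c p, symmetric])
  also have "\<dots> = (mat_adjoint D * D) $$ (p, p)" using D p by simp
  also have "\<dots> = 1" by (rule gram_diag[OF p])
  finally have "(cvec_norm (col D p))\<^sup>2 = 1" by (simp only: of_real_eq_1_iff)
  then have "cvec_norm (col D p) = 1"
    using cvec_norm_nonneg[of "col D p"] by (simp add: power2_eq_1_iff)
  then show ?thesis using cvec_norm_Cauchy_Schwarz[of v "col D p"] v D by simp
qed

text \<open>The heart of the argument: while the selection is incomplete, the algorithm neither stops nor
  selects a wrong or repeated index.\<close>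

lemma residual_step:
  assumes \<alpha>: "\<alpha> \<in> supported_vec d \<Omega>" and e: "e \<in> carrier_vec n" and e\<epsilon>: "cvec_norm e < \<epsilon>"
    and big: "\<And>i. i \<in> \<Omega> \<Longrightarrow> 2 * \<epsilon> / (1 - a - b) \<le> cmod (\<alpha> $ i)"
    and S: "S \<subset> \<Omega>"
  defines "r \<equiv> residual D (D *\<^sub>v \<alpha> + e) S"
  shows "\<epsilon> < cvec_norm r"
    and "is_arg_max (\<lambda>i. cmod (r \<bullet>c col D i)) (\<lambda>i. i < d) i \<Longrightarrow> i \<in> \<Omega> - S"
proof -
  have Sd: "S \<subseteq> {..<d}" and ind: "columns_independent D S"
    using S \<Omega> columns_independent_subset by auto
  have \<alpha>c: "\<alpha> \<in> carrier_vec d" using \<alpha> by (simp add: supported_vec_def)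
  obtain \<beta> where \<beta>: "\<beta> \<in> supported_vec d \<Omega>" "\<And>i. i < d \<Longrightarrow> i \<notin> S \<Longrightarrow> \<beta> $ i = \<alpha> $ i"
    "residual D (D *\<^sub>v \<alpha>) S = D *\<^sub>v \<beta>"
    using residual_mult_mat_vec[OF D Sd ind \<alpha>] S by blast
  note \<beta>\<Omega> = \<beta>(1)
  have \<beta>c: "\<beta> \<in> carrier_vec d" using \<beta>\<Omega> by (simp add: supported_vec_def)
  define f where "f = residual D e S"
  have f: "f \<in> carrier_vec n" "cvec_norm f < \<epsilon>"
    unfolding f_def using residual_carrier[OF D Sd ind e] cvec_norm_residual_le[OF D Sd ind e] e\<epsilon>
    by auto
  have D\<alpha>: "D *\<^sub>v \<alpha> \<in> carrier_vec n" and D\<beta>: "D *\<^sub>v \<beta> \<in> carrier_vec n" using D \<alpha>c \<beta>c by auto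
  have r: "r = D *\<^sub>v \<beta> + f"
    unfolding r_def f_def residual_add[OF D Sd ind D\<alpha> e] \<beta>(3) ..
  have rc: "r \<in> carrier_vec n" unfolding r using D\<beta> f by simp
  have corr: "r \<bullet>c col D p = (D *\<^sub>v \<beta>) \<bullet>c col D p + f \<bullet>c col D p" for p
  proof -
    have "conjugate (col D p) \<in> carrier_vec n" by (rule carrier_vecI) (use D in simp)
    then show ?thesis unfolding r by (rule add_scalar_prod_distrib[OF D\<beta> f(1)])
  qed
  have f_corr: "cmod (f \<bullet>c col D p) < \<epsilon>" if "p < d" for p
    using cmod_cscalar_col_le[OF f(1) that] f(2) by simp
  obtain p where p: "p \<in> \<Omega>" "\<And>q. q \<in> \<Omega> \<Longrightarrow> cmod (\<beta> $ q) \<le> cmod (\<beta> $ p)"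
    using exists_peak[of \<beta>] S by blast
  define M where "M = cmod (\<beta> $ p)"
  have pd: "p < d" using p \<Omega> by auto
  obtain q where q: "q \<in> \<Omega>" "q \<notin> S" using S by blast
  \<comment> \<open>The coefficients outside \<open>S\<close> are still those of the signal, so the peak is at least their size.\<close>
  have "2 * \<epsilon> / (1 - a - b) \<le> M"
    using big[OF q(1)] \<beta>(2)[of q] p(2)[OF q(1)] q \<Omega> by (auto simp: M_def)
  then have M: "2 * \<epsilon> \<le> M * (1 - a - b)" using ab by (simp add: pos_divide_le_eq)
  have M0: "0 \<le> M" by (simp add: M_def)
  then have Mb: "0 \<le> M * b" using b_nonneg by simp
  have peak: "M * (1 - a) - \<epsilon> < cmod (r \<bullet>c col D p)"
    using correlation_at_peak_ge[OF \<beta>\<Omega> p] f_corr[OF pd]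
      norm_diff_ineq[of "(D *\<^sub>v \<beta>) \<bullet>c col D p" "f \<bullet>c col D p"]
    unfolding corr M_def by linarith
  moreover have "\<epsilon> \<le> M * (1 - a) - \<epsilon>" using M Mb by (simp add: algebra_simps)
  ultimately have above: "\<epsilon> < cmod (r \<bullet>c col D p)" by linarith
  then show "\<epsilon> < cvec_norm r" using cmod_cscalar_col_le[OF rc pd] by simp
  show "i \<in> \<Omega> - S" if "is_arg_max (\<lambda>i. cmod (r \<bullet>c col D i)) (\<lambda>i. i < d) i"
  proof -
    have i: "i < d" and "\<not> cmod (r \<bullet>c col D p) > cmod (r \<bullet>c col D i)"
      using that pd unfolding is_arg_max_def by blast+
    then have max: "cmod (r \<bullet>c col D p) \<le> cmod (r \<bullet>c col D i)" by simp
    have "i \<notin> S"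
    proof
      assume "i \<in> S"
      moreover have "D *\<^sub>v \<alpha> + e \<in> carrier_vec n" using D\<alpha> e by simp
      ultimately have "r \<bullet>c col D i = 0" unfolding r_def using residual_orthogonal[OF D Sd ind] by blast
      then show False using max above cvec_norm_nonneg[of e] e\<epsilon> by simp
    qed
    moreover have "i \<in> \<Omega>"
    proof (rule ccontr)
      assume "i \<notin> \<Omega>"
      then have "cmod ((D *\<^sub>v \<beta>) \<bullet>c col D i) \<le> M * b"
        using correlation_outside_le[OF \<beta>\<Omega> _ M0 i] p(2) by (simp add: M_def)
      then have "cmod (r \<bullet>c col D i) < M * b + \<epsilon>"
        using f_corr[OF i] norm_triangle_ineq[of "(D *\<^sub>v \<beta>) \<bullet>c col D i" "f \<bullet>c col D i"]
        unfolding corr by linarith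
      moreover have "M * b + \<epsilon> \<le> M * (1 - a) - \<epsilon>" using M by (simp add: algebra_simps)
      ultimately show False using peak max by linarith
    qed
    ultimately show ?thesis by simp
  qed
qed

text \<open>After complete selection the residual of the signal is supported on \<open>\<Omega>\<close> and orthogonal to
  every column of \<open>\<Omega>\<close>, so it vanishes and only projected noise is left.\<close>

lemma residual_support_le:
  assumes \<alpha>: "\<alpha> \<in> supported_vec d \<Omega>" and e: "e \<in> carrier_vec n"
  shows "cvec_norm (residual D (D *\<^sub>v \<alpha> + e) \<Omega>) \<le> cvec_norm e"
proof -
  have ind: "columns_independent D \<Omega>" by (rule columns_independent_subset) simp
  have \<alpha>c: "\<alpha> \<in> carrier_vec d" using \<alpha> by (simp add: supported_vec_def)
  have D\<alpha>: "D *\<^sub>v \<alpha> \<in> carrier_vec n" using D \<alpha>c by auto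
  obtain \<beta> where \<beta>: "\<beta> \<in> supported_vec d \<Omega>" "\<And>i. i < d \<Longrightarrow> i \<notin> \<Omega> \<Longrightarrow> \<beta> $ i = \<alpha> $ i"
    "residual D (D *\<^sub>v \<alpha>) \<Omega> = D *\<^sub>v \<beta>"
    using residual_mult_mat_vec[OF D \<Omega> ind \<alpha>] by blast
  have "\<beta> = 0\<^sub>v d"
    using \<beta>(1) by (rule uncorrelated_imp_zero) (simp only: \<beta>(3)[symmetric] residual_orthogonal[OF D \<Omega> ind D\<alpha>])
  then have "residual D (D *\<^sub>v \<alpha>) \<Omega> = 0\<^sub>v n" using \<beta>(3) D by auto
  then have "residual D (D *\<^sub>v \<alpha> + e) \<Omega> = residual D e \<Omega>"
    using residual_add[OF D \<Omega> ind D\<alpha> e] residual_carrier[OF D \<Omega> ind e] by simp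
  then show ?thesis using cvec_norm_residual_le[OF D \<Omega> ind e] by simp
qed

lemma omp_recovers_support:
  assumes \<alpha>: "\<alpha> \<in> supported_vec d \<Omega>" and e: "e \<in> carrier_vec n" and e\<epsilon>: "cvec_norm e < \<epsilon>"
    and big: "\<And>i. i \<in> \<Omega> \<Longrightarrow> 2 * \<epsilon> / (1 - a - b) \<le> cmod (\<alpha> $ i)"
    and run: "omp_run D (D *\<^sub>v \<alpha> + e) \<epsilon> W r"
  shows "omp_outputs \<epsilon> W r \<Omega>"
proof -
  define x where "x = D *\<^sub>v \<alpha> + e"
  have x: "x \<in> carrier_vec n" using D \<alpha> e by (auto simp: x_def supported_vec_def)
  have step: "if cvec_norm (r t) \<le> \<epsilon>
      then W (Suc t) = W t \<and> r (Suc t) = r t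
      else (\<exists>i. is_arg_max (\<lambda>i. cmod (r t \<bullet>c col D i)) (\<lambda>i. i < dim_col D) i \<and>
                W (Suc t) = W t \<union> {i}) \<and> r (Suc t) = residual D x (W (Suc t))" for t
    using run unfolding omp_run_def residual_def x_def by blast
  \<comment> \<open>The initial residual is not defined through a projection; the empty projection is zero, so the
    uniform description of residuals covers it too.\<close>
  have residual_empty: "residual D x {} = x"
  proof -
    have ind: "columns_independent D {}" by (rule columns_independent_subset) simp
    obtain \<gamma> where \<gamma>: "\<gamma> \<in> supported_vec d {}" "column_projection D {} *\<^sub>v x = D *\<^sub>v \<gamma>"
      using column_projection_range[OF D _ ind x] by auto
    have "\<gamma> = 0\<^sub>v d" using \<gamma>(1) by (intro eq_vecI) (auto simp: supported_vec_def)
    then have "column_projection D {} *\<^sub>v x = 0\<^sub>v n" using \<gamma>(2) D by auto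
    then show ?thesis using residual_eq_minus[OF D _ ind x] x by simp
  qed
  have res: "r t = residual D x (W t)" for t
  proof (induction t)
    case 0
    then show ?case using run residual_empty by (simp add: omp_run_def x_def)
  next
    case (Suc t)
    then show ?case using step[of t] by (auto split: if_splits)
  qed
  have progress: "\<epsilon> < cvec_norm (r t) \<and> (\<exists>i\<in>\<Omega> - W t. W (Suc t) = insert i (W t))"
    if "W t \<subset> \<Omega>" for t
  proof -
    note st = residual_step[OF \<alpha> e e\<epsilon> big that, folded x_def, folded res]
    then show ?thesis using step[of t] D by auto
  qed
  have count: "W t \<subseteq> \<Omega> \<and> card (W t) = t" if "t \<le> card \<Omega>" for t
    using that
  proof (induction t)
    case 0
    then show ?case using run by (simp add: omp_run_def)
  next
    case (Suc t)
    then have W: "W t \<subseteq> \<Omega>" "card (W t) = t" and "W t \<noteq> \<Omega>" by auto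
    then obtain i where "i \<in> \<Omega> - W t" "W (Suc t) = insert i (W t)"
      using progress[of t] by blast
    moreover have "finite (W t)" using W(1) finite_\<Omega> finite_subset by blast
    ultimately show ?case using W by simp
  qed
  have "W (card \<Omega>) = \<Omega>" using count[of "card \<Omega>"] finite_\<Omega> card_subset_eq by blast
  moreover have "cvec_norm (r (card \<Omega>)) \<le> \<epsilon>"
    using residual_support_le[OF \<alpha> e] e\<epsilon> unfolding res calculation x_def by simp
  moreover have "\<not> cvec_norm (r t) \<le> \<epsilon>" if "t < card \<Omega>" for t
  proof -
    have "W t \<subset> \<Omega>" using count[of t] that by auto
    then show ?thesis using progress[of t] by simp
  qed
  ultimately show ?thesis unfolding omp_outputs_def by blast
qed

end

section \<open>The DFT dictionary and its dominance factors\<close>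

lemma dft_dictionary_carrier: "dft_dictionary n d \<in> carrier_mat n d"
  by (simp add: dft_dictionary_def)

lemma gram_dft_dictionary_diag:
  assumes n: "1 \<le> n" and p: "p < d"
  shows "(mat_adjoint (dft_dictionary n d) * dft_dictionary n d) $$ (p, p) = 1"
proof -
  define D where "D = dft_dictionary n d"
  have D: "D \<in> carrier_mat n d" unfolding D_def by (rule dft_dictionary_carrier)
  have "cmod (exp (- 2 * complex_of_real pi * \<i> / of_nat d)) = 1" by simp
  then have "cmod (D $$ (j, p)) = 1 / sqrt (real n)" if "j < n" for j
    using that p by (simp add: D_def dft_dictionary_def norm_divide norm_power)
  then have entry: "cnj (D $$ (j, p)) * D $$ (j, p) = of_real (1 / real n)" if "j < n" for j
    using that complex_norm_square[of "D $$ (j, p)"]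
    by (simp add: mult.commute power_divide flip: of_real_power)
  have "(mat_adjoint D * D) $$ (p, p) = (\<Sum>j<n. cnj (D $$ (j, p)) * D $$ (j, p))"
    using D p by (auto simp: scalar_prod_def index_mat_adjoint atLeast0LessThan intro!: sum.cong)
  also have "\<dots> = 1" using n by (simp add: entry)
  finally show ?thesis unfolding D_def .
qed

lemma finite_separated_sets: "finite (separated_sets d k h)"
  by (rule finite_subset[of _ "Pow {..<d}"]) (auto simp: separated_sets_def)

lemma le_Max_Max0:
  assumes "finite \<S>" "\<Omega> \<in> \<S>" "finite (A \<Omega>)" "y \<in> A \<Omega>"
  shows "y \<le> Max ((\<lambda>\<Omega>. Max0 (A \<Omega>)) ` \<S>)"
proof -
  have "y \<le> Max0 (A \<Omega>)" using assms(3,4) by (auto simp: Max0_def)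
  also have "\<dots> \<le> Max ((\<lambda>\<Omega>. Max0 (A \<Omega>)) ` \<S>)" using assms(1,2) by (intro Max_ge) auto
  finally show ?thesis .
qed

lemma row_sum_le_dominance:
  assumes \<Omega>: "\<Omega> \<in> separated_sets (dim_col D) k h" and p: "p \<in> \<Omega>"
  shows "(\<Sum>q\<in>\<Omega> - {p}. cmod ((mat_adjoint D * D) $$ (p, q))) \<le> dominance D h k"
  unfolding dominance_def
proof (rule le_Max_Max0[OF finite_separated_sets \<Omega>])
  have "\<Omega> \<subseteq> {..<dim_col D}" using \<Omega> by (simp add: separated_sets_def)
  then have "finite \<Omega>" by (rule finite_subset) simp
  then show "finite ((\<lambda>p. \<Sum>q\<in>\<Omega> - {p}. cmod ((mat_adjoint D * D) $$ (p, q))) ` \<Omega>)"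
    by (rule finite_imageI)
qed (rule imageI[OF p])

lemma row_sum_le_dominance':
  assumes \<Omega>: "\<Omega> \<in> separated_sets (dim_col D) k h" and p: "p < dim_col D" "p \<notin> \<Omega>"
  shows "(\<Sum>q\<in>\<Omega>. cmod ((mat_adjoint D * D) $$ (p, q))) \<le> dominance' D h k"
  unfolding dominance'_def
proof (rule le_Max_Max0[OF finite_separated_sets \<Omega>])
  show "(\<Sum>q\<in>\<Omega>. cmod ((mat_adjoint D * D) $$ (p, q)))
      \<in> (\<lambda>p. \<Sum>q\<in>\<Omega>. cmod ((mat_adjoint D * D) $$ (p, q))) ` ({..<dim_col D} - \<Omega>)"
    by (rule imageI) (use p in simp)
qed simp

text \<open>If no index lies outside \<open>\<Omega>\<close>, the inner maximum is the default value \<open>0\<close>.\<close>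

lemma dominance'_nonneg:
  assumes \<Omega>: "\<Omega> \<in> separated_sets (dim_col D) k h"
  shows "0 \<le> dominance' D h k"
proof (cases "{..<dim_col D} - \<Omega> = {}")
  case True
  have "0 = Max0 ((\<lambda>p. \<Sum>q\<in>\<Omega>. cmod ((mat_adjoint D * D) $$ (p, q))) ` ({..<dim_col D} - \<Omega>))"
    unfolding True by (simp add: Max0_def)
  also have "\<dots> \<le> dominance' D h k"
    unfolding dominance'_def by (intro Max_ge finite_imageI finite_separated_sets imageI \<Omega>)
  finally show ?thesis .
next
  case False
  then obtain p where p: "p < dim_col D" "p \<notin> \<Omega>" by blast
  have "0 \<le> (\<Sum>q\<in>\<Omega>. cmod ((mat_adjoint D * D) $$ (p, q)))" by (simp add: sum_nonneg)
  also have "\<dots> \<le> dominance' D h k" by (rule row_sum_le_dominance'[OF \<Omega> p])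
  finally show ?thesis .
qed

section \<open>Exact recovery\<close>

lemma finsum_vec_cols_eq_mult:
  fixes D :: "complex mat"
  assumes D: "D \<in> carrier_mat n d" and \<Omega>: "\<Omega> \<subseteq> {..<d}" and \<alpha>: "\<alpha> \<in> supported_vec d \<Omega>"
  shows "finsum_vec TYPE(complex) n (\<lambda>i. \<alpha> $ i \<cdot>\<^sub>v col D i) \<Omega> = D *\<^sub>v \<alpha>"
proof (rule eq_vecI)
  have fin: "finite \<Omega>" using \<Omega> finite_subset by blast
  have cols: "(\<lambda>i. \<alpha> $ i \<cdot>\<^sub>v col D i) \<in> \<Omega> \<rightarrow> carrier_vec n"
    by (intro Pi_I carrier_vecI) (use D in simp)
  have \<alpha>c: "\<alpha> \<in> carrier_vec d" using \<alpha> by (simp add: supported_vec_def)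
  show "dim_vec (finsum_vec TYPE(complex) n (\<lambda>i. \<alpha> $ i \<cdot>\<^sub>v col D i) \<Omega>) = dim_vec (D *\<^sub>v \<alpha>)"
    using finsum_vec_closed[OF cols] D by auto
  fix i assume "i < dim_vec (D *\<^sub>v \<alpha>)"
  then have i: "i < n" using D by simp
  have "finsum_vec TYPE(complex) n (\<lambda>i. \<alpha> $ i \<cdot>\<^sub>v col D i) \<Omega> $ i
      = (\<Sum>l\<in>\<Omega>. (\<alpha> $ l \<cdot>\<^sub>v col D l) $ i)"
    by (rule index_finsum_vec[OF fin i cols])
  also have "\<dots> = (\<Sum>l\<in>\<Omega>. D $$ (i, l) * \<alpha> $ l)"
    using D \<Omega> i by (intro sum.cong) auto
  also have "\<dots> = (\<Sum>l<d. D $$ (i, l) * \<alpha> $ l)"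
    using \<Omega> \<alpha> by (intro sum.mono_neutral_left) (auto simp: supported_vec_def)
  also have "\<dots> = (D *\<^sub>v \<alpha>) $ i"
    using D i \<alpha>c by (simp add: scalar_prod_def atLeast0LessThan)
  finally show "finsum_vec TYPE(complex) n (\<lambda>i. \<alpha> $ i \<cdot>\<^sub>v col D i) \<Omega> $ i = (D *\<^sub>v \<alpha>) $ i" .
qed

theorem theorem3p5:
  fixes n d k h_min :: nat
    and D :: "complex mat"
    and \<alpha> e x :: "complex vec"
    and \<epsilon> :: real
    and \<Omega>_opt :: "nat set"
  assumes "1 \<le> n" and "n \<le> d" and "1 \<le> h_min"
    and "D = dft_dictionary n d"
    and "\<alpha> \<in> carrier_vec d"
    and "\<Omega>_opt = {i. i < d \<and> \<alpha> $ i \<noteq> 0}"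
    and "\<Omega>_opt \<in> separated_sets d k h_min"
    and "e \<in> carrier_vec n"
    and "cvec_norm e < \<epsilon>"
    and "x = finsum_vec TYPE(complex) n (\<lambda>i. \<alpha> $ i \<cdot>\<^sub>v col D i) \<Omega>_opt + e"
    and "dominance D h_min k < 1"
    and "dominance' D h_min k / (1 - dominance D h_min k) < 1"
    and "\<forall>i\<in>\<Omega>_opt. cmod (\<alpha> $ i) \<ge> 2 * \<epsilon> / (1 - dominance D h_min k - dominance' D h_min k)"
  shows "\<forall>\<Omega> r. omp_run D x \<epsilon> \<Omega> r \<longrightarrow> omp_outputs \<epsilon> \<Omega> r \<Omega>_opt"
proof (intro allI impI)
  fix \<Omega> r assume run: "omp_run D x \<epsilon> \<Omega> r"
  let ?a = "dominance D h_min k" and ?b = "dominance' D h_min k"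
  have D: "D \<in> carrier_mat n d" using assms(4) dft_dictionary_carrier by simp
  have sub: "\<Omega>_opt \<subseteq> {..<d}" using assms(6) by auto
  have sep: "\<Omega>_opt \<in> separated_sets (dim_col D) k h_min" using assms(7) D by simp
  have dimD: "dim_col D = d" using D by simp
  interpret dominant_columns D n d \<Omega>_opt ?a ?b
  proof (rule dominant_columns.intro[OF D sub])
    show "(mat_adjoint D * D) $$ (p, p) = 1" if "p < d" for p
      unfolding assms(4) by (rule gram_dft_dictionary_diag[OF assms(1) that])
    show "?a + ?b < 1" using assms(11,12) by (simp add: pos_divide_less_eq)
  qed (use row_sum_le_dominance[OF sep] row_sum_le_dominance'[OF sep] dominance'_nonneg[OF sep]
      in \<open>simp_all only: dimD\<close>)
  have \<alpha>: "\<alpha> \<in> supported_vec d \<Omega>_opt" using assms(5,6) by (auto simp: supported_vec_def)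
  have "x = D *\<^sub>v \<alpha> + e" using assms(10) finsum_vec_cols_eq_mult[OF D sub \<alpha>] by simp
  then show "omp_outputs \<epsilon> \<Omega> r \<Omega>_opt"
    using omp_recovers_support[OF \<alpha> assms(8,9)] assms(13) run by blast
qed

end
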